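(* Let $(X,Y,M)$ be any random triple, where $Y$ is discrete. Then $$ \mathbb{E}_{X,M}\left[\gamma(X,M)\,\mathbf{1}\{f^*_{\mathrm{pool}}(X)\neq f^*_{\mathrm{DI}}(X,M)\}\right]\;\le\; R^*_{\mathrm{pool}}-R^*_{\mathrm{DI}}\;\le\;\mathbb{E}_{X,M}\left[\mathbf{1}\{f^*_{\mathrm{pool}}(X)\neq f^*_{\mathrm{DI}}(X,M)\}\right]. $$
   Context: $X$, $Y$, $M$ are jointly distributed random variables with values in measurable spaces $\mathcal{X}$, $\mathcal{Y}$, $\mathcal{M}$ respectively, where $\mathcal{Y}$ is a countable set with at least two elements (the class labels, e.g. $\{1,\dots,K\}$). $X$ is a feature vector and $M$ is "metadata". Fix versions of the conditional probabilities $\mathbb{P}(Y=k\mid X=x)$ and $\mathbb{P}(Y=k\mid X=x,M=m)$ that are probability mass functions in $k$. $\mathbf{1}\{\cdot\}$ is the indicator of an event. Bayes classifiers: $f^*_{\mathrm{pool}}(x)=\arg\max_k \mathbb{P}(Y=k\mid X=x)$ and $f^*_{\mathrm{DI}}(x,m)=\arg\max_k \mathbb{P}(Y=k\mid X=x,M=m)$, where in case of ties any measurable choice of a maximizer is fixed. Bayes risks: $R^*_{\mathrm{pool}}=\mathbb{E}_{X,Y}[\mathbf{1}\{f^*_{\mathrm{pool}}(X)\ne Y\}]=\mathbb{E}_X[1-\max_k\mathbb{P}(Y=k\mid X)]$ and $R^*_{\mathrm{DI}}=\mathbb{E}_{X,Y,M}[\mathbf{1}\{f^*_{\mathrm{DI}}(X,M)\ne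 Y\}]=\mathbb{E}_{X,M}[1-\max_k\mathbb{P}(Y=k\mid X,M)]$. Point-wise margin: $\gamma(x,m)=\max_k\mathbb{P}(Y=k\mid X=x,M=m)-\operatorname{2nd}\max_k\mathbb{P}(Y=k\mid X=x,M=m)$, where $\operatorname{2nd}\max_k$ returns the second largest value counted with multiplicity (so $\gamma(x,m)=0$ if the maximum is attained by two or more labels). *)

theory Defs
  imports "HOL-Probability.Probability"
begin

text \<open>
  \<open>p\<close> is a version of the conditional probability mass function
  \<open>z \<mapsto> (k \<mapsto> P(Y = k | Z = z))\<close>, where \<open>Z\<close> takes values in \<open>N\<close> and \<open>Y\<close> in the label set \<open>S\<close>.
  The conditioning \<open>\<sigma>\<close>-algebra is the one generated by \<open>Z\<close>.
\<close>

definition cond_pmf_version ::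
  "'w measure \<Rightarrow> 'y set \<Rightarrow> ('w \<Rightarrow> 'y) \<Rightarrow> 'z measure \<Rightarrow> ('w \<Rightarrow> 'z) \<Rightarrow> ('z \<Rightarrow> 'y pmf) \<Rightarrow> bool" where
  "cond_pmf_version P S Y N Z p \<longleftrightarrow>
     (\<forall>z\<in>space N. set_pmf (p z) \<subseteq> S) \<and>
     (\<forall>k\<in>S. (\<lambda>z. pmf (p z) k) \<in> borel_measurable N \<and>
        (AE \<omega> in P. real_cond_exp P (vimage_algebra (space P) Z N)
                       (indicator {\<omega>\<in>space P. Y \<omega> = k}) \<omega> = pmf (p (Z \<omega>)) k))"

definition bayes_classifier ::
  "'y set \<Rightarrow> 'z measure \<Rightarrow> ('z \<Rightarrow> 'y pmf) \<Rightarrow> ('z \<Rightarrow> 'y) \<Rightarrow> bool" where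
  "bayes_classifier S N p f \<longleftrightarrow>
     f \<in> measurable N (count_space S) \<and>
     (\<forall>z\<in>space N. is_arg_max (pmf (p z)) (\<lambda>k. k \<in> S) (f z))"

definition risk :: "'w measure \<Rightarrow> ('w \<Rightarrow> 'y) \<Rightarrow> ('w \<Rightarrow> 'z) \<Rightarrow> ('z \<Rightarrow> 'y) \<Rightarrow> real" where
  "risk P Y Z f = (\<integral>\<omega>. of_bool (f (Z \<omega>) \<noteq> Y \<omega>) \<partial>P)"

text \<open>
  The second largest value counted with multiplicity: one maximizer is removed, and the
  value does not depend on which one. Since \<open>S\<close> may be infinite, maxima are written as
  suprema; for a probability mass function these are attained. The set \<open>S\<close> must have at least
  two elements.
\<close>

definition second_max :: "'y set \<Rightarrow> ('y \<Rightarrow> real) \<Rightarrow> real" where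
  "second_max S g = (SUP k\<in>S - {arg_max_on g S}. g k)"

definition margin :: "'y set \<Rightarrow> 'y pmf \<Rightarrow> real" where
  "margin S q = (SUP k\<in>S. pmf q k) - second_max S (pmf q)"

end

(* Both risks are computed from the single pmf p_DI: whenever h is a measurable function of
   Z = (X, M), conditioning on Z gives P(h(Z) = Y) = E[pmf (p_DI Z) (h Z)], and f_pool is such a
   function. Hence the regret is the expectation of pmf (p_DI Z) (f_DI Z) - pmf (p_DI Z) (f_pool X),
   which vanishes where the classifiers agree and lies between the margin and 1 where they differ. *)
theory Submission imports Defs begin

lemma nn_integral_count_space_singleton:
  assumes "a \<in> A" and "\<And>x. x \<in> A \<Longrightarrow> x \<noteq> a \<Longrightarrow> f x = 0"
  shows "(\<integral>\<^sup>+x. f x \<partial>count_space A) = f a"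
  using assms by (subst nn_integral_count_space'[where A = "{a}"]) auto

text \<open>The event \<open>h (Z \<omega>) = k\<close> belongs to the sigma-algebra generated by
  \<open>Z\<close>, so the defining property of conditional expectation, integrated over it, turns
  the indicator of \<open>Y \<omega> = k\<close> into \<open>pmf (p (Z \<omega>)) k\<close>.
  Nonnegative integrals let the labels be summed later by Tonelli, with no summability to
  check.\<close>

lemma cond_pmf_version_joint_prob:
  assumes "prob_space P"
    and Z: "Z \<in> measurable P N" and Y: "Y \<in> measurable P (count_space S)"
    and p: "cond_pmf_version P S Y N Z p" and h: "h \<in> measurable N (count_space S)"
    and k: "k \<in> S"
  shows "(\<integral>\<^sup>+\<omega>. of_bool (h (Z \<omega>) = k \<and> Y \<omega> = k) \<partial>P)
       = (\<integral>\<^sup>+\<omega>. of_bool (h (Z \<omega>) = k) * ennreal (pmf (p (Z \<omega>)) k) \<partial>P)"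
proof -
  interpret prob_space P by fact
  let ?F = "vimage_algebra (space P) Z N"
  let ?A = "{\<omega>\<in>space P. h (Z \<omega>) = k}" and ?B = "{\<omega>\<in>space P. Y \<omega> = k}"
  interpret finite_measure_subalgebra P ?F
    using sets_image_in_sets[OF refl Z] by unfold_locales (simp add: subalgebra_def)
  have "h -` {k} \<inter> space N \<in> sets N"
    using measurable_sets[OF h, of "{k}"] k by simp
  \<comment> \<open>\<open>?A\<close> is the preimage under \<open>Z\<close> of a measurable set of
    \<open>N\<close>. Membership in \<open>?F\<close>, and not only in \<open>sets P\<close>, is
    what \<open>real_cond_exp_intA\<close> asks for.\<close>
  from in_vimage_algebra[OF this, of Z "space P"] have AF: "?A \<in> sets ?F"
    using measurable_space[OF Z] by (auto elim!: back_subst[of "\<lambda>A. A \<in> sets ?F"])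
  then have A[measurable]: "?A \<in> sets P"
    using subalg by (auto simp: subalgebra_def)
  have B[measurable]: "?B \<in> sets P"
    using measurable_sets[OF Y, of "{k}"] k
    by (auto elim!: back_subst[of "\<lambda>A. A \<in> sets P"])
  have pk: "(\<lambda>z. pmf (p z) k) \<in> borel_measurable N"
    and ae: "AE \<omega> in P. real_cond_exp P ?F (indicator ?B) \<omega> = pmf (p (Z \<omega>)) k"
    using p k by (auto simp: cond_pmf_version_def)
  have pkZ[measurable]: "(\<lambda>\<omega>. pmf (p (Z \<omega>)) k) \<in> borel_measurable P"
    using measurable_compose[OF Z pk] .
  have "integrable P (indicator ?B :: _ \<Rightarrow> real)"
    by (intro integrable_real_indicator B) (simp add: less_top[symmetric])
  from real_cond_exp_intA[OF this AF]
  have "(\<integral>\<omega>. indicator ?A \<omega> * indicator ?B \<omega> \<partial>P)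
      = (\<integral>\<omega>. indicator ?A \<omega> * real_cond_exp P ?F (indicator ?B) \<omega> \<partial>P)"
    by (simp add: set_lebesgue_integral_def)
  also have "\<dots> = (\<integral>\<omega>. indicator ?A \<omega> * pmf (p (Z \<omega>)) k \<partial>P)"
  proof (rule integral_cong_AE)
    show "AE \<omega> in P. indicator ?A \<omega> * real_cond_exp P ?F (indicator ?B) \<omega>
        = indicator ?A \<omega> * pmf (p (Z \<omega>)) k"
      using ae by eventually_elim simp
  qed measurable
  finally have eq: "(\<integral>\<omega>. indicator ?A \<omega> * indicator ?B \<omega> \<partial>P)
      = (\<integral>\<omega>. indicator ?A \<omega> * pmf (p (Z \<omega>)) k \<partial>P)" .
  have "(\<integral>\<^sup>+\<omega>. of_bool (h (Z \<omega>) = k \<and> Y \<omega> = k) \<partial>P)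
      = (\<integral>\<^sup>+\<omega>. ennreal (indicator ?A \<omega> * indicator ?B \<omega>) \<partial>P)"
    by (intro nn_integral_cong) (auto simp: indicator_def)
  \<comment> \<open>The two integrands of \<open>eq\<close> lie between 0 and 1 on a probability
    space, hence are integrable, and \<open>eq\<close> carries over to nonnegative
    integrals.\<close>
  also have "\<dots> = ennreal (\<integral>\<omega>. indicator ?A \<omega> * indicator ?B \<omega> \<partial>P)"
    by (intro nn_integral_eq_integral integrable_const_bound[where B = 1] AE_I2)
       (auto split: split_indicator)
  also have "\<dots> = (\<integral>\<^sup>+\<omega>. ennreal (indicator ?A \<omega> * pmf (p (Z \<omega>)) k) \<partial>P)"
    unfolding eq
    by (intro nn_integral_eq_integral[symmetric] integrable_const_bound[where B = 1] AE_I2)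
       (auto split: split_indicator simp: pmf_le_1)
  also have "\<dots> = (\<integral>\<^sup>+\<omega>. of_bool (h (Z \<omega>) = k) * ennreal (pmf (p (Z \<omega>)) k) \<partial>P)"
    by (intro nn_integral_cong) (auto simp: indicator_def)
  finally show ?thesis .
qed

text \<open>\<open>S\<close> is countable, so \<open>h\<close> cuts \<open>N\<close> into countably
  many measurable pieces; on the piece where \<open>h\<close> is \<open>k\<close> the function is
  \<open>pmf (p z) k\<close>, measurable by the choice of version.\<close>

lemma measurable_pmf_classifier:
  assumes S: "countable S" and Z: "Z \<in> measurable P N"
    and p: "cond_pmf_version P S Y N Z p" and h: "h \<in> measurable N (count_space S)"
  shows "(\<lambda>\<omega>. pmf (p (Z \<omega>)) (h (Z \<omega>))) \<in> borel_measurable P"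
proof -
  have "(\<lambda>z. pmf (p z) (h z)) \<in> borel_measurable N"
    by (rule measurable_compose_countable'[where f = "\<lambda>k z. pmf (p z) k", OF _ h S])
       (use p in \<open>auto simp: cond_pmf_version_def\<close>)
  then show ?thesis
    by (rule measurable_compose[OF Z])
qed

text \<open>The event of a correct prediction is the disjoint union over \<open>k \<in> S\<close> of
  \<open>h (Z \<omega>) = k \<and> Y \<omega> = k\<close>, and
  \<open>cond_pmf_version_joint_prob\<close> evaluates each piece. Since \<open>h\<close> is an
  arbitrary measurable classifier, the formula serves both risks in the theorem.\<close>

lemma risk_eq:
  assumes "prob_space P" and S: "countable S"
    and Z: "Z \<in> measurable P N" and Y: "Y \<in> measurable P (count_space S)"
    and p: "cond_pmf_version P S Y N Z p" and h: "h \<in> measurable N (count_space S)"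
  shows "risk P Y Z h = 1 - (\<integral>\<omega>. pmf (p (Z \<omega>)) (h (Z \<omega>)) \<partial>P)"
proof -
  interpret prob_space P by fact
  have hZ[measurable]: "(\<lambda>\<omega>. h (Z \<omega>)) \<in> measurable P (count_space S)"
    using measurable_compose[OF Z h] .
  note Y[measurable]
  have in_S: "h (Z \<omega>) \<in> S" if "\<omega> \<in> space P" for \<omega>
    using measurable_space[OF hZ that] by simp
  have pk[measurable]: "(\<lambda>\<omega>. pmf (p (Z \<omega>)) k) \<in> borel_measurable P" if "k \<in> S" for k
    using p that by (intro measurable_compose[OF Z]) (auto simp: cond_pmf_version_def)
  have eqk[measurable]: "Measurable.pred P (\<lambda>\<omega>. h (Z \<omega>) = k)" "Measurable.pred P (\<lambda>\<omega>. Y \<omega> = k)"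
    if "k \<in> S" for k
    using that by measurable
  \<comment> \<open>Both sides of the equation vary with \<open>\<omega>\<close>; fixing the
    countably many values of \<open>h (Z \<omega>)\<close> reduces it to the events
    \<open>Y \<omega> = k\<close>.\<close>
  have agree[measurable]: "Measurable.pred P (\<lambda>\<omega>. h (Z \<omega>) = Y \<omega>)"
    by (rule measurable_compose_countable'[where f = "\<lambda>k \<omega>. k = Y \<omega>", OF _ hZ S]) measurable
  note pmf_hZ[measurable] = measurable_pmf_classifier[OF S Z p h]
  have "ennreal (\<integral>\<omega>. of_bool (h (Z \<omega>) = Y \<omega>) \<partial>P)
      = (\<integral>\<^sup>+\<omega>. of_bool (h (Z \<omega>) = Y \<omega>) \<partial>P)"
    by (subst nn_integral_eq_integral[symmetric])
       (auto intro!: integrable_const_bound[where B = 1] nn_integral_cong)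
  \<comment> \<open>A sum over labels is inserted in which only \<open>k = h (Z \<omega>)\<close>
    can contribute. After the exchange with the integral and the replacement for each label, it
    collapses to that same term.\<close>
  also have "\<dots> = (\<integral>\<^sup>+\<omega>. \<integral>\<^sup>+k. of_bool (h (Z \<omega>) = k \<and> Y \<omega> = k) \<partial>count_space S \<partial>P)"
    by (intro nn_integral_cong, subst nn_integral_count_space_singleton[OF in_S]) auto
  also have "\<dots> = (\<integral>\<^sup>+k. \<integral>\<^sup>+\<omega>. of_bool (h (Z \<omega>) = k \<and> Y \<omega> = k) \<partial>P \<partial>count_space S)"
    by (intro nn_integral_count_space_nn_integral S) measurable
  also have "\<dots> = (\<integral>\<^sup>+k. \<integral>\<^sup>+\<omega>. of_bool (h (Z \<omega>) = k) * ennreal (pmf (p (Z \<omega>)) k) \<partial>P \<partial>count_space S)"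
    by (intro nn_integral_cong cond_pmf_version_joint_prob[OF \<open>prob_space P\<close> Z Y p h]) simp
  also have "\<dots> = (\<integral>\<^sup>+\<omega>. \<integral>\<^sup>+k. of_bool (h (Z \<omega>) = k) * ennreal (pmf (p (Z \<omega>)) k) \<partial>count_space S \<partial>P)"
    by (intro nn_integral_count_space_nn_integral[symmetric] S) measurable
  also have "\<dots> = (\<integral>\<^sup>+\<omega>. ennreal (pmf (p (Z \<omega>)) (h (Z \<omega>))) \<partial>P)"
    by (intro nn_integral_cong, subst nn_integral_count_space_singleton[OF in_S]) auto
  also have "\<dots> = ennreal (\<integral>\<omega>. pmf (p (Z \<omega>)) (h (Z \<omega>)) \<partial>P)"
    by (intro nn_integral_eq_integral integrable_const_bound[where B = 1]) (auto simp: pmf_le_1)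
  finally have "(\<integral>\<omega>. of_bool (h (Z \<omega>) = Y \<omega>) \<partial>P) = (\<integral>\<omega>. pmf (p (Z \<omega>)) (h (Z \<omega>)) \<partial>P)"
    by (subst (asm) ennreal_inj) (auto intro!: integral_nonneg)
  moreover have "risk P Y Z h = (\<integral>\<omega>. 1 - of_bool (h (Z \<omega>) = Y \<omega>) \<partial>P)"
    unfolding risk_def by (intro Bochner_Integration.integral_cong) auto
  moreover have "\<dots> = 1 - (\<integral>\<omega>. of_bool (h (Z \<omega>) = Y \<omega>) \<partial>P)"
    by (subst Bochner_Integration.integral_diff)
       (auto intro!: integrable_const_bound[where B = 1] simp: prob_space)
  ultimately show ?thesis by simp
qed

text \<open>The first supremum is attained at \<open>a\<close>, so it remains to bound
  \<open>second_max\<close> below by \<open>pmf q b\<close>. The label it removes is some choice of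
  maximizer, which under ties can differ from \<open>a\<close> and even be \<open>b\<close>.\<close>

lemma margin_le_pmf_diff:
  assumes a: "is_arg_max (pmf q) (\<lambda>k. k \<in> S) a" and b: "b \<in> S" "b \<noteq> a"
  shows "margin S q \<le> pmf q a - pmf q b"
proof -
  have aS: "a \<in> S" and max: "\<And>k. k \<in> S \<Longrightarrow> pmf q k \<le> pmf q a"
    using a unfolding is_arg_max_linorder by blast+
  have "(SUP k\<in>S. pmf q k) = pmf q a"
    using aS max b by (intro cSup_eq_maximum) auto
  moreover have "pmf q b \<le> second_max S (pmf q)"
  proof -
    let ?c = "arg_max_on (pmf q) S"
    have bdd: "bdd_above (pmf q ` (S - {?c}))"
      by (rule bdd_aboveI[of _ 1]) (auto simp: pmf_le_1)
    \<comment> \<open>at least one of the two labels survives the removal of the chosen maximizer\<close>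
    consider "b \<noteq> ?c" | "a \<noteq> ?c" using b by metis
    then show ?thesis
    proof cases
      case 1
      then show ?thesis
        unfolding second_max_def using b bdd by (intro cSUP_upper) auto
    next
      case 2
      \<comment> \<open>Here \<open>b\<close> may be the removed label, so the bound goes through
        \<open>a\<close>, which survives.\<close>
      have "pmf q b \<le> pmf q a" using max b by blast
      also have "\<dots> \<le> second_max S (pmf q)"
        unfolding second_max_def using aS b 2 bdd by (intro cSUP_upper) auto
      finally show ?thesis .
    qed
  qed
  ultimately show ?thesis by (simp add: margin_def)
qed

theorem theorem1:
  fixes P :: "'w measure"
    and MX :: "'x measure" and MM :: "'m measure" and S :: "'y set"
    and X :: "'w \<Rightarrow> 'x" and M :: "'w \<Rightarrow> 'm" and Y :: "'w \<Rightarrow> 'y"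
    and p_pool :: "'x \<Rightarrow> 'y pmf" and p_DI :: "'x \<times> 'm \<Rightarrow> 'y pmf"
    and f_pool :: "'x \<Rightarrow> 'y" and f_DI :: "'x \<times> 'm \<Rightarrow> 'y"
  assumes "prob_space P"
    and "countable S" and "\<exists>a\<in>S. \<exists>b\<in>S. a \<noteq> b"
    and "X \<in> measurable P MX"
    and "M \<in> measurable P MM"
    and "Y \<in> measurable P (count_space S)"
    and "cond_pmf_version P S Y MX X p_pool"
    and "cond_pmf_version P S Y (MX \<Otimes>\<^sub>M MM) (\<lambda>\<omega>. (X \<omega>, M \<omega>)) p_DI"
    and "bayes_classifier S MX p_pool f_pool"
    and "bayes_classifier S (MX \<Otimes>\<^sub>M MM) p_DI f_DI"
  shows "(\<integral>\<omega>. margin S (p_DI (X \<omega>, M \<omega>)) * of_bool (f_pool (X \<omega>) \<noteq> f_DI (X \<omega>, M \<omega>)) \<partial>P)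
           \<le> risk P Y X f_pool - risk P Y (\<lambda>\<omega>. (X \<omega>, M \<omega>)) f_DI
       \<and> risk P Y X f_pool - risk P Y (\<lambda>\<omega>. (X \<omega>, M \<omega>)) f_DI
           \<le> (\<integral>\<omega>. of_bool (f_pool (X \<omega>) \<noteq> f_DI (X \<omega>, M \<omega>)) \<partial>P)"
proof -
  interpret prob_space P by fact
  note S = assms(2) and X[measurable] = assms(4) and M[measurable] = assms(5)
  let ?Z = "\<lambda>\<omega>. (X \<omega>, M \<omega>)" and ?N = "MX \<Otimes>\<^sub>M MM"
  \<comment> \<open>The pooled classifier, viewed as a classifier on pairs that ignores the
    metadata.\<close>
  let ?h = "\<lambda>z. f_pool (fst z)"
  \<comment> \<open>The conditional probability of a correct label that is lost at
    \<open>\<omega>\<close> by predicting with \<open>f_pool\<close> in place of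
    \<open>f_DI\<close>.\<close>
  define d where "d \<omega> = pmf (p_DI (?Z \<omega>)) (f_DI (?Z \<omega>)) - pmf (p_DI (?Z \<omega>)) (f_pool (X \<omega>))" for \<omega>
  have Z: "?Z \<in> measurable P ?N" by measurable
  have fp: "f_pool \<in> measurable MX (count_space S)"
    and fd: "f_DI \<in> measurable ?N (count_space S)"
    and arg_max: "\<And>z. z \<in> space ?N \<Longrightarrow> is_arg_max (pmf (p_DI z)) (\<lambda>k. k \<in> S) (f_DI z)"
    using assms(9,10) by (auto simp: bayes_classifier_def)
  have h: "?h \<in> measurable ?N (count_space S)"
    using measurable_compose[OF measurable_fst fp] .
  note fpX[measurable] = measurable_compose[OF X fp]
    and fdZ[measurable] = measurable_compose[OF Z fd]
  have [measurable]: "Measurable.pred P (\<lambda>\<omega>. f_pool (X \<omega>) = f_DI (?Z \<omega>))"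
    by (rule measurable_compose_countable'[where f = "\<lambda>k \<omega>. k = f_DI (?Z \<omega>)", OF _ fpX S]) measurable
  have int: "integrable P (\<lambda>\<omega>. pmf (p_DI (?Z \<omega>)) (g (?Z \<omega>)))"
    if "g \<in> measurable ?N (count_space S)" for g
    using measurable_pmf_classifier[OF S Z assms(8) that]
    by (intro integrable_const_bound[where B = 1]) (auto simp: pmf_le_1)
  have int_d: "integrable P d"
    unfolding d_def using int[OF fd] int[OF h] by simp
  \<comment> \<open>The risk depends only on the predicted labels, so \<open>risk_eq\<close> can be
    applied with \<open>p_DI\<close> to both classifiers; the constants 1 then cancel in the
    difference.\<close>
  have "risk P Y X f_pool = risk P Y ?Z ?h"
    by (simp add: risk_def)
  then have regret: "risk P Y X f_pool - risk P Y ?Z f_DI = (\<integral>\<omega>. d \<omega> \<partial>P)"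
    unfolding d_def using int[OF fd] int[OF h]
    by (simp add: risk_eq[OF \<open>prob_space P\<close> S Z assms(6,8)] h fd)
  have lower: "margin S (p_DI (?Z \<omega>)) * of_bool (f_pool (X \<omega>) \<noteq> f_DI (?Z \<omega>)) \<le> d \<omega>"
    and nonneg: "0 \<le> d \<omega>"
    and upper: "d \<omega> \<le> of_bool (f_pool (X \<omega>) \<noteq> f_DI (?Z \<omega>))" if "\<omega> \<in> space P" for \<omega>
  proof -
    have pS: "f_pool (X \<omega>) \<in> S"
      using measurable_space[OF fpX that] by simp
    have am: "is_arg_max (pmf (p_DI (?Z \<omega>))) (\<lambda>k. k \<in> S) (f_DI (?Z \<omega>))"
      using arg_max measurable_space[OF Z that] by blast
    \<comment> \<open>Where the predictions agree both sides are 0. Elsewhere \<open>f_DI\<close>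
      supplies the maximizer and \<open>f_pool\<close> the competing label.\<close>
    show "margin S (p_DI (?Z \<omega>)) * of_bool (f_pool (X \<omega>) \<noteq> f_DI (?Z \<omega>)) \<le> d \<omega>"
      using margin_le_pmf_diff[OF am pS] by (cases "f_pool (X \<omega>) = f_DI (?Z \<omega>)") (auto simp: d_def)
    show "0 \<le> d \<omega>"
      using am pS by (auto simp: d_def is_arg_max_linorder)
    have "d \<omega> \<le> 1"
      using pmf_le_1[of "p_DI (?Z \<omega>)" "f_DI (?Z \<omega>)"]
        pmf_nonneg[of "p_DI (?Z \<omega>)" "f_pool (X \<omega>)"] unfolding d_def by linarith
    then show "d \<omega> \<le> of_bool (f_pool (X \<omega>) \<noteq> f_DI (?Z \<omega>))"
      by (cases "f_pool (X \<omega>) = f_DI (?Z \<omega>)") (auto simp: d_def)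
  qed
  \<comment> \<open>The margin need not be measurable, in which case its integral is \<open>0\<close>;
    \<open>integral_mono'\<close> covers this because \<open>d\<close> is nonnegative.\<close>
  have "(\<integral>\<omega>. margin S (p_DI (?Z \<omega>)) * of_bool (f_pool (X \<omega>) \<noteq> f_DI (?Z \<omega>)) \<partial>P) \<le> (\<integral>\<omega>. d \<omega> \<partial>P)"
    using int_d lower nonneg by (rule integral_mono')
  moreover have "(\<integral>\<omega>. d \<omega> \<partial>P) \<le> (\<integral>\<omega>. of_bool (f_pool (X \<omega>) \<noteq> f_DI (?Z \<omega>)) \<partial>P)"
    using upper by (intro integral_mono[OF int_d] integrable_const_bound[where B = 1]) auto
  ultimately show ?thesis
    unfolding regret by blast
qed

end
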